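(* Let $d(n)$ denote the number of positive divisors of $n$ and $d^{\ast}(n)$ the number of unitary divisors of $n$, i.e. $d^{\ast}(n)=\#\{d\mid n:\ \gcd(d,n/d)=1\}$. Let $\mathcal{B}$ be the set of positive integers $n$ such that $n$ is not a multiple of $5$ but some permutation of the decimal digits of $n$ is a multiple of $5$. Then for every $\varepsilon>0$ and every real $x\geq 1$, \[ \sum_{\substack{n\leq x\\ n\in\mathcal{B}}}\frac{d(n)}{d^{\ast}(n)}=\frac{16\pi^{2}}{123}\prod_{p}\Big(1-\frac{1}{2p^{2}}+\frac{1}{2p^{3}}\Big)\,x+\mathcal{O}\big(x^{\frac{\ln 8}{\ln 10}+\varepsilon}\big), \] where the product runs over all primes $p$ and the implied constant depends only on $\varepsilon$. (Here $\frac{\pi^{2}}{6}\prod_{p}(1-\frac{1}{2p^{2}}+\frac{1}{2p^{3}})\approx 1.4276565$.)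
   Context: Digits refer to the base-10 representation. A positive integer is called $\mathcal{B}$-multiple of $5$ if it is not a multiple of $5$ but some permutation of its digits is a multiple of $5$; $\mathcal{B}$ is the set of such integers (e.g. $51,53,107,151$). *)

theory Defs
  imports
    "HOL-Analysis.Analysis"
    "HOL-Computational_Algebra.Primes"
    "HOL-Library.Multiset"
begin

text \<open>Decimal digits, least significant first, without padding zeros.\<close>

function decimal_digits :: "nat \<Rightarrow> nat list" where
  "decimal_digits n = (if n = 0 then [] else n mod 10 # decimal_digits (n div 10))"
  by auto
termination
  by (relation "Wellfounded.measure id") auto

declare decimal_digits.simps [simp del]

abbreviation decimal_value :: "nat list \<Rightarrow> nat" where
  "decimal_value ds \<equiv> horner_sum (\<lambda>d. d) 10 ds"

lemma decimal_value_digits: "decimal_value (decimal_digits n) = n"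
proof (induction n rule: decimal_digits.induct)
  case (1 n)
  show ?case
  proof (cases "n = 0")
    case False
    with 1 have "decimal_value (decimal_digits (n div 10)) = n div 10" by simp
    with False show ?thesis by (subst decimal_digits.simps) simp
  qed (simp add: decimal_digits.simps)
qed

text \<open>
  A rearrangement may have leading zeros. Forbidding them would give the same set: if \<open>n\<close> is not
  a multiple of \<open>5\<close> then its last digit is nonzero, and exchanging it with a digit
  \<open>0\<close> or \<open>5\<close> of \<open>n\<close> leaves a nonzero leading digit.
\<close>

definition B_multiples_of_5 :: "nat set" where
  "B_multiples_of_5 =
     {n. n > 0 \<and> \<not> 5 dvd n \<and>
         (\<exists>ds. mset ds = mset (decimal_digits n) \<and> 5 dvd decimal_value ds)}"

definition num_divisors :: "nat \<Rightarrow> nat" where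
  "num_divisors n = card {d. d dvd n}"

definition num_unitary_divisors :: "nat \<Rightarrow> nat" where
  "num_unitary_divisors n = card {d. d dvd n \<and> gcd d (n div d) = 1}"

definition euler_factor :: "nat \<Rightarrow> real" where
  "euler_factor p = 1 - 1 / (2 * real p ^ 2) + 1 / (2 * real p ^ 3)"

definition euler_product :: real where
  "euler_product = (\<Prod>p. if prime p then euler_factor p else 1)"

text \<open>The product converges, so the value of \<^const>\<open>prodinf\<close> is the intended one.\<close>

lemma convergent_euler_product: "convergent_prod (\<lambda>p. if prime p then euler_factor p else 1)"
proof (rule abs_convergent_prod_imp_convergent_prod, rule summable_imp_abs_convergent_prod,
       rule summable_comparison_test')
  show "summable (\<lambda>p::nat. 1 / real p ^ 2)"
    using inverse_power_summable[of 2, where 'a = real] by (simp add: field_simps)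
next
  fix p :: nat
  assume "p \<ge> 1"
  hence "1 / real p ^ 3 \<le> 1 / real p ^ 2"
    by (intro divide_left_mono power_increasing) auto
  moreover have "1 / real p ^ 3 \<ge> 0" by simp
  moreover have "euler_factor p - 1 = (1 / real p ^ 3) / 2 - (1 / real p ^ 2) / 2"
    by (simp add: euler_factor_def)
  moreover have "\<bar>c\<bar> \<le> b" if "a \<le> b" "0 \<le> a" "c = a / 2 - b / 2" for a b c :: real
    using that by linarith
  ultimately have "\<bar>euler_factor p - 1\<bar> \<le> 1 / real p ^ 2" by blast
  thus "norm (norm ((if prime p then euler_factor p else 1) - 1)) \<le> 1 / real p ^ 2"
    by simp
qed

end

theory Submission imports Defs begin

text \<open>
  A positive integer not divisible by \<open>5\<close> fails to lie in the set exactly when none of its digits is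
  \<open>0\<close> or \<open>5\<close>. Only \<open>O(x\<^bsup>ln 8 / ln 10\<^esup>)\<close> integers up to \<open>x\<close> have this property, and each contributes
  \<open>O(x\<^bsup>\<epsilon>\<^esup>)\<close>, so it remains to sum \<open>f(n) = d(n) / d\<^sup>*(n)\<close> over all \<open>n \<le> x\<close> prime to \<open>5\<close>.

  Write \<open>f(n) = \<Sum>d | n. g(d)\<close> with \<open>g\<close> multiplicative, \<open>g(p) = 0\<close> and \<open>g(p\<^sup>k) = 1/2\<close> for \<open>k \<ge> 2\<close>. The
  sum becomes \<open>\<Sum>d. g(d) N(x/d)\<close> over \<open>d\<close> prime to \<open>5\<close>, where \<open>N(y)\<close> counts the integers up to \<open>y\<close> prime
  to \<open>5\<close>. Since \<open>\<bar>N(y) - 4y/5\<bar> \<le> y\<^sup>s\<close> for \<^emph>\<open>all\<close> \<open>y > 0\<close> and \<open>0 \<le> s \<le> 1\<close>, replacing \<open>N\<close> by its main term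
  costs at most \<open>x\<^sup>s \<Sum>d. g(d) d\<^bsup>-s\<^esup>\<close>, which is finite for \<open>s > 1/2\<close> by its Euler product. The constant
  is \<open>4/5 \<Sum>g(d)/d\<close>, whose Euler factors \<open>1 + 1/(2p(p-1))\<close> equal those of \<open>\<zeta>(2)\<close> times
  \<open>1 - 1/(2p\<^sup>2) + 1/(2p\<^sup>3)\<close>; dropping the factor \<open>41/40\<close> at \<open>p = 5\<close> gives \<open>16\<pi>\<^sup>2/123\<close>.
\<close>

section \<open>Euler products of nonnegative multiplicative functions\<close>

text \<open>At 0 the condition is vacuous, since \<open>coprime 0 b\<close> forces
  \<open>b = 1\<close>; the value \<open>h 0\<close> is therefore free.\<close>

definition multiplicative :: "(nat \<Rightarrow> real) \<Rightarrow> bool" where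
  "multiplicative h \<longleftrightarrow> h 1 = 1 \<and> (\<forall>a b. coprime a b \<longrightarrow> h (a * b) = h a * h b)"

lemma multiplicative_1: "multiplicative h \<Longrightarrow> h (Suc 0) = 1"
  by (simp add: multiplicative_def)

lemma multiplicative_prime_power_mult:
  assumes "multiplicative h" "prime p" "\<not> p dvd m"
  shows "h (p ^ k * m) = h (p ^ k) * h m"
  using assms by (simp add: multiplicative_def prime_imp_coprime)

lemma multiplicative_mult:
  "multiplicative g \<Longrightarrow> multiplicative h \<Longrightarrow> multiplicative (\<lambda>n. g n * h n)"
  by (auto simp: multiplicative_def)

lemma multiplicative_powr: "multiplicative (\<lambda>n. real n powr s)"
  by (auto simp: multiplicative_def powr_mult)

lemma multiplicative_not_dvd: "prime p \<Longrightarrow> multiplicative (\<lambda>n. if p dvd n then 0 else 1)"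
  by (auto simp: multiplicative_def prime_dvd_mult_iff)

text \<open>Splitting off the whole power of one prime factor leaves a smaller cofactor prime to it.
  Multiplicative functions are then controlled by their values at prime powers.\<close>

lemma prime_power_induct [consumes 1, case_names one step]:
  assumes "n > (0::nat)" "P 1"
    and step: "\<And>p k m. prime p \<Longrightarrow> k > 0 \<Longrightarrow> m > 0 \<Longrightarrow> \<not> p dvd m \<Longrightarrow> P m \<Longrightarrow> P (p ^ k * m)"
  shows "P n"
  using assms(1)
proof (induction n rule: less_induct)
  case (less n)
  show ?case
  proof (cases "n = 1")
    case False
    then obtain p where p: "prime p" "p dvd n" using prime_factor_nat by blast
    obtain m where m: "n = p ^ multiplicity p n * m" "\<not> p dvd m"
      using multiplicity_decompose'[of n p] less.prems p by (metis not_prime_unit not_gr0)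
    have k: "multiplicity p n > 0"
      using p less.prems by (simp add: prime_multiplicity_gt_zero_iff)
    have "m > 0" using m less.prems by (cases m) auto
    moreover have "p ^ multiplicity p n > 1"
      using k prime_gt_1_nat[OF p(1)] by (intro one_less_power)
    ultimately have "m < n" by (subst m(1)) simp
    then have "P (p ^ multiplicity p n * m)"
      using less.IH[of m] \<open>m > 0\<close> m(2) k p(1) by (intro step) auto
    then show ?thesis using m(1) by simp
  qed (use assms(2) in simp)
qed

text \<open>Each divisor factors uniquely as \<open>p ^ i * d\<close> with \<open>d\<close> dividing
  \<open>m\<close>: the exponent \<open>i\<close> is recovered as the multiplicity of
  \<open>p\<close>, because \<open>p\<close> does not divide \<open>d\<close>.\<close>

lemma sum_divisors_prime_power_mult:
  fixes F :: "nat \<Rightarrow> 'a :: comm_monoid_add"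
  assumes p: "prime p" and m: "m > 0" "\<not> p dvd m"
  shows "(\<Sum>d | d dvd p ^ k * m. F d) = (\<Sum>i\<le>k. \<Sum>d | d dvd m. F (p ^ i * d))"
proof -
  have p0: "p > 0" using p prime_gt_0_nat by blast
  have ndvd: "\<not> p dvd d" if "d dvd m" for d using that m(2) dvd_trans by blast
  have "bij_betw (\<lambda>(i, d). p ^ i * d) ({..k} \<times> {d. d dvd m}) {d. d dvd p ^ k * m}"
  proof (rule bij_betwI'; clarsimp)
    fix i d j e assume "d dvd m" "e dvd m"
    then have "i = j" if "p ^ i * d = p ^ j * e"
      using that multiplicity_decomposeI[of "p ^ i * d" p i d]
        multiplicity_decomposeI[of "p ^ i * d" p j e] ndvd p0 by auto
    then show "(p ^ i * d = p ^ j * e) = (i = j \<and> d = e)"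
      using p0 by auto
  next
    fix i d assume "i \<le> k" "d dvd m"
    then show "p ^ i * d dvd p ^ k * m" by (intro mult_dvd_mono le_imp_power_dvd)
  next
    fix d assume "d dvd p ^ k * m"
    then obtain a b where ab: "d = a * b" "a dvd p ^ k" "b dvd m"
      using division_decomp by blast
    then obtain i where "i \<le> k" "a = p ^ i"
      using divides_primepow_nat[OF p] by blast
    then show "\<exists>i\<in>{..k}. \<exists>e. e dvd m \<and> d = p ^ i * e" using ab by auto
  qed
  from sum.reindex_bij_betw[OF this, of F, symmetric]
  have "(\<Sum>d | d dvd p ^ k * m. F d) = (\<Sum>(i, d) \<in> {..k} \<times> {d. d dvd m}. F (p ^ i * d))"
    by (simp add: case_prod_unfold)
  also have "\<dots> = (\<Sum>i\<le>k. \<Sum>d | d dvd m. F (p ^ i * d))"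
    by (rule sum.cartesian_product[symmetric])
  finally show ?thesis .
qed

text \<open>Only summability needs an argument. A finite set of pairs lies in the rectangle spanned
  by its projections, where the sum factors and is at most \<open>S * T\<close>.\<close>

lemma has_sum_product_nonneg:
  fixes f :: "'a \<Rightarrow> real" and g :: "'b \<Rightarrow> real"
  assumes f: "(f has_sum S) A" and g: "(g has_sum T) B"
    and nn: "\<And>x. x \<in> A \<Longrightarrow> f x \<ge> 0" "\<And>y. y \<in> B \<Longrightarrow> g y \<ge> 0"
  shows "((\<lambda>(x, y). f x * g y) has_sum S * T) (A \<times> B)"
proof (rule has_sum_SigmaI)
  show "((\<lambda>y. case (x, y) of (x, y) \<Rightarrow> f x * g y) has_sum f x * T) B" if "x \<in> A" for x
    using has_sum_cmult_right[OF g, of "f x"] by simp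
  show "((\<lambda>x. f x * T) has_sum S * T) A" using has_sum_cmult_left[OF f, of T] .
  show "(\<lambda>(x, y). f x * g y) summable_on A \<times> B"
  proof (rule nonneg_bdd_above_summable_on)
    have S: "S \<ge> 0" using has_sum_nonneg[OF f] nn by auto
    show "bdd_above (sum (\<lambda>(x, y). f x * g y) ` {F. F \<subseteq> A \<times> B \<and> finite F})"
    proof (rule bdd_aboveI2)
      fix F assume "F \<in> {F. F \<subseteq> A \<times> B \<and> finite F}"
      then have F: "F \<subseteq> A \<times> B" "finite F" by auto
      have "sum (\<lambda>(x, y). f x * g y) F \<le> sum (\<lambda>(x, y). f x * g y) (fst ` F \<times> snd ` F)"
      proof (rule sum_mono2)
        show "F \<subseteq> fst ` F \<times> snd ` F" by force
        show "0 \<le> (\<lambda>(x, y). f x * g y) b" if "b \<in> fst ` F \<times> snd ` F - F" for b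
          using that F nn by (auto intro!: mult_nonneg_nonneg)
      qed (use F in auto)
      also have "\<dots> = sum f (fst ` F) * sum g (snd ` F)"
        by (simp add: sum_product sum.cartesian_product)
      also have "\<dots> \<le> S * T"
        using F nn S by (intro mult_mono finite_sum_le_has_sum[OF f] finite_sum_le_has_sum[OF g] sum_nonneg)
          auto
      finally show "sum (\<lambda>(x, y). f x * g y) F \<le> S * T" .
    qed
  qed (use nn in auto)
qed

text \<open>Induction on \<open>P\<close>: a number with prime factors in \<open>insert p P\<close>
  is uniquely \<open>p ^ k * m\<close> with the prime factors of \<open>m\<close> in
  \<open>P\<close>, so the new sum is the old one times the local series at
  \<open>p\<close>.\<close>

lemma has_sum_smooth_numbers:
  fixes h :: "nat \<Rightarrow> real"
  assumes h: "multiplicative h" and nn: "\<And>n. h n \<ge> 0"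
    and P: "finite P" "\<And>p. p \<in> P \<Longrightarrow> prime p"
    and F: "\<And>p. p \<in> P \<Longrightarrow> ((\<lambda>k. h (p ^ k)) has_sum F p) UNIV"
  shows "(h has_sum (\<Prod>p\<in>P. F p)) {n. n > 0 \<and> prime_factors n \<subseteq> P}"
  using P F
proof (induction P rule: finite_induct)
  case empty
  have "{n::nat. n > 0 \<and> prime_factors n \<subseteq> {}} = {1}"
    by (auto simp: prime_factorization_empty_iff)
  then show ?case using h by (simp add: multiplicative_1 has_sum_finite_iff)
next
  case (insert p P)
  let ?S = "\<lambda>P. {n::nat. n > 0 \<and> prime_factors n \<subseteq> P}"
  have p: "prime p" using insert by auto
  have ndvd: "\<not> p dvd m" if "m \<in> ?S P" for m
    using that insert.hyps p by (auto simp: prime_factors_dvd)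
  have "((\<lambda>(k, m). h (p ^ k) * h m) has_sum F p * prod F P) ((UNIV :: nat set) \<times> ?S P)"
    using insert by (intro has_sum_product_nonneg nn insert.IH) auto
  also have "?this \<longleftrightarrow> (h has_sum F p * prod F P) (?S (insert p P))"
  proof (rule has_sum_reindex_bij_witness[where
        j = "\<lambda>(k, m). p ^ k * m" and i = "\<lambda>n. (multiplicity p n, n div p ^ multiplicity p n)"])
    fix a :: "nat \<times> nat" assume "a \<in> UNIV \<times> ?S P"
    then obtain k m where a: "a = (k, m)" "m \<in> ?S P" by auto
    have mult: "multiplicity p (p ^ k * m) = k"
      using ndvd[OF a(2)] p by (intro multiplicity_decomposeI) auto
    show "(\<lambda>n. (multiplicity p n, n div p ^ multiplicity p n)) ((\<lambda>(k, m). p ^ k * m) a) = a"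
      using a mult p by (auto simp: prime_gt_0_nat)
    show "(\<lambda>(k, m). p ^ k * m) a \<in> ?S (insert p P)"
      using a p by (auto simp: prime_factorization_mult prime_factorization_prime_power prime_gt_0_nat
          split: if_splits)
    show "h ((\<lambda>(k, m). p ^ k * m) a) = (\<lambda>(k, m). h (p ^ k) * h m) a"
      using a multiplicative_prime_power_mult[OF h p ndvd] by auto
  next
    fix n assume n: "n \<in> ?S (insert p P)"
    show "(\<lambda>(k, m). p ^ k * m) (multiplicity p n, n div p ^ multiplicity p n) = n"
      by (simp add: multiplicity_dvd)
    obtain m where m: "n = p ^ multiplicity p n * m" "\<not> p dvd m"
      using multiplicity_decompose'[of n p] n p by (metis (mono_tags, lifting) mem_Collect_eq not_prime_unit not_gr0)
    have "n div p ^ multiplicity p n = m"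
      using p by (subst m(1)) (auto simp: prime_gt_0_nat)
    moreover have "m > 0" using m n by (cases m) auto
    moreover have "prime_factors m \<subseteq> P"
    proof
      fix q assume q: "q \<in> prime_factors m"
      then have "q dvd n" by (subst m(1)) (auto simp: prime_factors_dvd)
      then have "q \<in> prime_factors n" using q n by (auto simp: prime_factors_dvd)
      then show "q \<in> P" using n q m(2) by (auto simp: prime_factors_dvd)
    qed
    ultimately show "(multiplicity p n, n div p ^ multiplicity p n) \<in> UNIV \<times> ?S P" by auto
  qed simp
  finally show ?case using insert.hyps by simp
qed

context
  fixes h F :: "nat \<Rightarrow> real"
  assumes h: "multiplicative h" and nn: "\<And>n. h n \<ge> 0"
    and F: "\<And>p. prime p \<Longrightarrow> ((\<lambda>k. h (p ^ k)) has_sum F p) UNIV"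
begin

text \<open>Each positive n \<le> N has only prime factors \<le> N, so it occurs among the smooth
  numbers over which the finite product sums \<open>h\<close>.\<close>

lemma sum_le_euler_product: "(\<Sum>n\<in>{0<..N}. h n) \<le> (\<Prod>p | prime p \<and> p \<le> N. F p)"
proof (rule finite_sum_le_has_sum[OF has_sum_smooth_numbers[OF h nn]])
  show "{0<..N} \<subseteq> {n. n > 0 \<and> prime_factors n \<subseteq> {p. prime p \<and> p \<le> N}}"
    by (auto simp: prime_factors_dvd) (meson dvd_imp_le order_trans)
qed (use nn F in auto)

lemma summable_on_if_euler_product_bounded:
  assumes "\<And>N. (\<Prod>p | prime p \<and> p \<le> N. F p) \<le> B"
  shows "h summable_on {0<..}"
proof (rule nonneg_bdd_above_summable_on[OF nn], rule bdd_aboveI2)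
  fix A :: "nat set" assume "A \<in> {A. A \<subseteq> {0<..} \<and> finite A}"
  then have "sum h A \<le> (\<Sum>n\<in>{0<..Max A}. h n)"
    using nn by (intro sum_mono2) auto
  also have "\<dots> \<le> B" using sum_le_euler_product assms order_trans by blast
  finally show "sum h A \<le> B" .
qed

text \<open>The product up to \<open>N\<close> sums \<open>h\<close> over a set of positive integers
  containing all those up to \<open>N\<close>, so it lies between that partial sum and
  \<open>S\<close>.\<close>

lemma euler_product_LIMSEQ:
  assumes "(h has_sum S) {0<..}"
  shows "(\<lambda>N. \<Prod>p | prime p \<and> p \<le> N. F p) \<longlonglongrightarrow> S"
proof (rule tendsto_sandwich)
  have "((\<lambda>n. h (Suc n)) has_sum S) UNIV"
    using has_sum_reindex[of Suc UNIV h S] assms by (simp add: o_def greaterThan_0)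
  then have "(\<lambda>N. \<Sum>n<N. h (Suc n)) \<longlonglongrightarrow> S"
    using has_sum_imp_sums sums_def by blast
  moreover have "(\<Sum>n<N. h (Suc n)) = (\<Sum>n\<in>{0<..N}. h n)" for N
    by (rule sum.reindex_bij_witness[of _ "\<lambda>n. n - 1" Suc]) auto
  ultimately show "(\<lambda>N. \<Sum>n\<in>{0<..N}. h n) \<longlonglongrightarrow> S" by simp
  show "\<forall>\<^sub>F N in sequentially. (\<Prod>p | prime p \<and> p \<le> N. F p) \<le> S"
    using nn F by (intro always_eventually allI has_sum_mono2[OF has_sum_smooth_numbers[OF h nn] assms]) auto
qed (use sum_le_euler_product in auto)

end

section \<open>The ratio of divisor counts\<close>

definition divisor_ratio :: "nat \<Rightarrow> real" where
  "divisor_ratio n = real (num_divisors n) / real (num_unitary_divisors n)"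

text \<open>The Moebius transform of \<open>divisor_ratio\<close>: for n > 0 it is 2^(-\<omega>(n))
  if n is squarefull and 0 otherwise, where \<omega> counts distinct prime factors.\<close>

definition ratio_kernel :: "nat \<Rightarrow> real" where
  "ratio_kernel n = (\<Prod>p\<in>prime_factors n. if multiplicity p n = 1 then 0 else 1 / 2)"

lemma ratio_kernel_nonneg: "ratio_kernel n \<ge> 0"
  by (auto simp: ratio_kernel_def intro!: prod_nonneg)

lemma multiplicative_ratio_kernel: "multiplicative ratio_kernel"
  unfolding multiplicative_def
proof (intro conjI allI impI)
  fix a b :: nat assume ab: "coprime a b"
  show "ratio_kernel (a * b) = ratio_kernel a * ratio_kernel b"
  proof (cases "a = 0 \<or> b = 0")
    case True
    then show ?thesis using ab by (auto simp: ratio_kernel_def)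
  next
    case False
    have mult: "multiplicity p (a * b) = multiplicity p a + multiplicity p b" if "prime p" for p
      using False that by (intro prime_elem_multiplicity_mult_distrib) auto
    have disj: "\<not> (p dvd a \<and> p dvd b)" if "prime p" for p
      using coprime_common_divisor_nat[OF ab, of p] that by auto
    have zero: "multiplicity p b = 0" if "p \<in> prime_factors a" for p
      using that disj[of p] by (intro not_dvd_imp_multiplicity_0) (auto simp: in_prime_factors_iff)
    have zero': "multiplicity p a = 0" if "p \<in> prime_factors b" for p
      using that disj[of p] by (intro not_dvd_imp_multiplicity_0) (auto simp: in_prime_factors_iff)
    have "prime_factors a \<inter> prime_factors b = {}"
      using disj by (auto simp: in_prime_factors_iff)
    then have "ratio_kernel (a * b) =
        (\<Prod>p\<in>prime_factors a. if multiplicity p (a * b) = 1 then 0 else 1 / 2) *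
        (\<Prod>p\<in>prime_factors b. if multiplicity p (a * b) = 1 then 0 else 1 / 2)"
      using False unfolding ratio_kernel_def
      by (subst prime_factors_product) (auto intro: prod.union_disjoint)
    also have "\<dots> = ratio_kernel a * ratio_kernel b"
      unfolding ratio_kernel_def
      by (intro arg_cong2[of _ _ _ _ "(*)"] prod.cong)
         (simp_all add: mult zero zero' in_prime_factors_imp_prime)
    finally show ?thesis .
  qed
qed (simp add: ratio_kernel_def)

lemma ratio_kernel_prime_power:
  assumes "prime p"
  shows "ratio_kernel (p ^ k) = (if k = 0 then 1 else if k = 1 then 0 else 1 / 2)"
  using assms by (simp add: ratio_kernel_def prime_factorization_prime_power)

text \<open>The terms are 1, then 0, then k - 1 copies of 1/2. The total is the ratio of the k + 1
  divisors of p^k to its 2 unitary ones.\<close>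

lemma sum_ratio_kernel_prime_power:
  assumes "prime p" "k > 0"
  shows "(\<Sum>i\<le>k. ratio_kernel (p ^ i)) = real (k + 1) / 2"
  using assms(2)
  by (induction k rule: nat_induct_non_zero) (auto simp: ratio_kernel_prime_power[OF assms(1)])

lemma num_divisors_prime_power_mult:
  assumes "prime p" "m > 0" "\<not> p dvd m"
  shows "num_divisors (p ^ k * m) = (k + 1) * num_divisors m"
  using sum_divisors_prime_power_mult[OF assms, of "\<lambda>_. 1 :: nat" k] by (simp add: num_divisors_def)

lemma num_unitary_divisors_eq_sum:
  assumes "n > 0"
  shows "num_unitary_divisors n = (\<Sum>d | d dvd n. if coprime d (n div d) then 1 else 0)"
proof -
  have "{d. d dvd n \<and> gcd d (n div d) = 1} = {d \<in> {d. d dvd n}. coprime d (n div d)}"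
    by (auto simp: coprime_iff_gcd_eq_1)
  then show ?thesis using assms by (simp add: num_unitary_divisors_def flip: sum.inter_filter)
qed

text \<open>A unitary divisor contains either all of \<open>p ^ k\<close> or no factor
  \<open>p\<close>, next to a unitary divisor of \<open>m\<close>; the two choices differ because
  \<open>k > 0\<close>.\<close>

lemma num_unitary_divisors_prime_power_mult:
  assumes p: "prime p" and m: "m > 0" "\<not> p dvd m" and k: "k > 0"
  shows "num_unitary_divisors (p ^ k * m) = 2 * num_unitary_divisors m"
proof -
  have p0: "p > 0" using p prime_gt_0_nat by blast
  \<comment> \<open>The codivisor is \<open>p ^ (k - i) * (m div d)\<close>, so for 0 < i < k the
    prime \<open>p\<close> divides both parts.\<close>
  have cop: "coprime (p ^ i * d) (p ^ k * m div (p ^ i * d)) \<longleftrightarrow> (i = 0 \<or> i = k) \<and> coprime d (m div d)"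
    if "i \<le> k" "d dvd m" for i d
  proof -
    obtain e where e: "m = d * e" using \<open>d dvd m\<close> by blast
    have "\<not> p dvd d" "\<not> p dvd e" using m(2) e by auto
    then have "coprime p d" "coprime p e" using p prime_imp_coprime by blast+
    moreover from this have "coprime d p" "coprime e p" by (simp_all add: coprime_commute)
    moreover have "p ^ k * m div (p ^ i * d) = p ^ (k - i) * e"
    proof -
      have "p ^ k = p ^ i * p ^ (k - i)" using \<open>i \<le> k\<close> by (simp flip: power_add)
      then have "p ^ k * m = (p ^ i * d) * (p ^ (k - i) * e)" by (simp add: e)
      moreover have "p ^ i * d > 0" using p0 m e by auto
      ultimately show ?thesis by simp
    qed
    moreover have "m div d = e" using e m by auto
    moreover have "\<not> coprime p p" using p by auto
    ultimately show ?thesis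
      using \<open>i \<le> k\<close> by auto
  qed
  have "num_unitary_divisors (p ^ k * m) =
      (\<Sum>i\<le>k. \<Sum>d | d dvd m. if coprime (p ^ i * d) (p ^ k * m div (p ^ i * d)) then 1 else 0)"
    using m p0 by (simp add: num_unitary_divisors_eq_sum sum_divisors_prime_power_mult[OF p m])
  also have "\<dots> = (\<Sum>i\<le>k. if i = 0 \<or> i = k then num_unitary_divisors m else 0)"
  proof (rule sum.cong[OF refl])
    fix i assume "i \<in> {..k}"
    then have "(\<Sum>d | d dvd m. if coprime (p ^ i * d) (p ^ k * m div (p ^ i * d)) then 1 else 0) =
        (\<Sum>d | d dvd m. if (i = 0 \<or> i = k) \<and> coprime d (m div d) then 1 else (0::nat))"
      by (intro sum.cong refl if_cong cop) auto
    then show "(\<Sum>d | d dvd m. if coprime (p ^ i * d) (p ^ k * m div (p ^ i * d)) then 1 else 0) =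
        (if i = 0 \<or> i = k then num_unitary_divisors m else 0)"
      using m by (simp add: num_unitary_divisors_eq_sum)
  qed
  also have "\<dots> = (\<Sum>i\<in>{0, k}. num_unitary_divisors m)"
    using k by (intro sum.mono_neutral_cong_right) auto
  also have "\<dots> = 2 * num_unitary_divisors m" using k by simp
  finally show ?thesis .
qed

lemma divisor_ratio_1: "divisor_ratio (Suc 0) = 1"
proof -
  have "{d::nat. d dvd 1 \<and> gcd d (Suc 0 div d) = 1} = {1}" by auto
  then show ?thesis by (simp add: divisor_ratio_def num_divisors_def num_unitary_divisors_def)
qed

lemma divisor_ratio_nonneg: "divisor_ratio n \<ge> 0"
  by (simp add: divisor_ratio_def)

lemma divisor_ratio_prime_power_mult:
  assumes "prime p" "m > 0" "\<not> p dvd m" "k > 0"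
  shows "divisor_ratio (p ^ k * m) = real (k + 1) / 2 * divisor_ratio m"
  unfolding divisor_ratio_def num_divisors_prime_power_mult[OF assms(1-3)]
    num_unitary_divisors_prime_power_mult[OF assms]
  by (simp add: algebra_simps)

text \<open>Both sides gain the factor (k + 1)/2 when a prime power p^k with k > 0 is split
  off.\<close>

lemma divisor_ratio_eq_sum:
  assumes "n > 0"
  shows "divisor_ratio n = (\<Sum>d | d dvd n. ratio_kernel d)"
  using assms
proof (induction n rule: prime_power_induct)
  case one
  then show ?case
    by (simp add: divisor_ratio_1 multiplicative_1[OF multiplicative_ratio_kernel])
next
  case (step p k m)
  have "(\<Sum>d | d dvd p ^ k * m. ratio_kernel d) =
      (\<Sum>i\<le>k. \<Sum>d | d dvd m. ratio_kernel (p ^ i) * ratio_kernel d)"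
    unfolding sum_divisors_prime_power_mult[OF step.hyps(1,3,4)]
  proof (intro sum.cong refl)
    fix i d assume "d \<in> {d. d dvd m}"
    then have "\<not> p dvd d" using step.hyps dvd_trans by blast
    then show "ratio_kernel (p ^ i * d) = ratio_kernel (p ^ i) * ratio_kernel d"
      using multiplicative_prime_power_mult multiplicative_ratio_kernel step.hyps by blast
  qed
  also have "\<dots> = (\<Sum>i\<le>k. ratio_kernel (p ^ i)) * (\<Sum>d | d dvd m. ratio_kernel d)"
    by (simp add: sum_product)
  also have "\<dots> = divisor_ratio (p ^ k * m)"
    using step by (simp add: sum_ratio_kernel_prime_power divisor_ratio_prime_power_mult)
  finally show ?case ..
qed

section \<open>The Dirichlet series of the kernel over integers prime to 5\<close>

lemma has_sum_half_geometric:
  fixes z :: real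
  assumes "0 \<le> z" "z < 1"
  shows "((\<lambda>k. (if k = 0 then 1 else if k = 1 then 0 else 1 / 2) * z ^ k) has_sum
           1 + z ^ 2 / (2 * (1 - z))) UNIV"
proof (rule sums_nonneg_imp_has_sum)
  let ?a = "\<lambda>k. (if k = 0 then 1 else if k = 1 then 0 else 1 / 2) * z ^ k"
  have "(\<lambda>k. z ^ 2 / 2 * z ^ k) sums (z ^ 2 / 2 * (1 / (1 - z)))"
    using assms by (intro sums_mult geometric_sums) auto
  \<comment> \<open>From exponent 2 on the series is geometric; the two skipped terms contribute 1
    and 0.\<close>
  then have "(\<lambda>k. ?a (k + 2)) sums (z ^ 2 / (2 * (1 - z)))"
    by (simp add: power2_eq_square mult_ac)
  then have "?a sums (z ^ 2 / (2 * (1 - z)) + (\<Sum>k<2. ?a k))"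
    by (subst (asm) sums_iff_shift) simp
  then show "?a sums (1 + z ^ 2 / (2 * (1 - z)))"
    by (simp add: numeral_2_eq_2 add.commute)
qed (use assms in auto)

text \<open>One family serves three purposes: \<open>s = 0\<close> gives the bare coefficients,
  \<open>s = 1\<close> the series in the main term, and an \<open>s\<close> between 1/2 and 1 the
  series in the error term.\<close>

definition coprime5_kernel :: "real \<Rightarrow> nat \<Rightarrow> real" where
  "coprime5_kernel s n = ratio_kernel n * (if 5 dvd n then 0 else 1) * real n powr (-s)"

lemma coprime5_kernel_nonneg: "coprime5_kernel s n \<ge> 0"
  by (simp add: coprime5_kernel_def ratio_kernel_nonneg)

lemma multiplicative_coprime5_kernel: "multiplicative (coprime5_kernel s)"
  unfolding coprime5_kernel_def
  by (intro multiplicative_mult multiplicative_ratio_kernel multiplicative_powr multiplicative_not_dvd) simp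

text \<open>The local factor at \<open>p\<close> of the series with exponent \<open>s\<close>. At 5
  only the zeroth power survives, which leaves 1.\<close>

definition coprime5_factor :: "real \<Rightarrow> nat \<Rightarrow> real" where
  "coprime5_factor s p =
     (if p = 5 then 1 else 1 + (real p powr (-s)) ^ 2 / (2 * (1 - real p powr (-s))))"

lemma prime_powr_neg_less_1:
  assumes "prime p" "s > 0"
  shows "real p powr (-s) < 1"
  using assms prime_gt_1_nat[of p] by (simp add: powr_less_one)

lemma has_sum_coprime5_kernel_prime_powers:
  assumes p: "prime p" and s: "s > 0"
  shows "((\<lambda>k. coprime5_kernel s (p ^ k)) has_sum coprime5_factor s p) UNIV"
proof (cases "p = 5")
  case True
  have "((\<lambda>k. coprime5_kernel s (p ^ k)) has_sum (\<Sum>k\<in>{0::nat}. coprime5_kernel s (p ^ k))) UNIV"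
    by (rule has_sum_finite_neutralI[of "{0}"]) (auto simp: True coprime5_kernel_def)
  then show ?thesis
    using True by (simp add: coprime5_factor_def multiplicative_1[OF multiplicative_coprime5_kernel])
next
  case False
  have "\<not> 5 dvd p" using p False primes_dvd_imp_eq[of 5 p] by auto
  then have "\<not> 5 dvd p ^ k" for k using prime_dvd_power[of 5 p k] by auto
  moreover have "real (p ^ k) powr (-s) = (real p powr (-s)) ^ k" for k
    using prime_gt_0_nat[OF p] by (simp add: powr_realpow[symmetric] powr_powr mult.commute powr_power)
  ultimately have "coprime5_kernel s (p ^ k) =
      (if k = 0 then 1 else if k = 1 then 0 else 1 / 2) * (real p powr (-s)) ^ k" for k
    by (simp add: coprime5_kernel_def ratio_kernel_prime_power[OF p])
  then show ?thesis
    using has_sum_half_geometric[of "real p powr (-s)"] prime_powr_neg_less_1[OF p s] False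
    by (simp add: coprime5_factor_def)
qed

text \<open>As the kernel vanishes at primes, the local factors are 1 + O(p^(-2s)). With 1 + u \<le>
  exp u, the finite products are bounded through the series of n^(-2s), which converges for s >
  1/2.\<close>

lemma summable_on_coprime5_kernel:
  assumes s: "s > 1 / 2"
  shows "coprime5_kernel s summable_on {0<..}"
proof (rule summable_on_if_euler_product_bounded[OF multiplicative_coprime5_kernel
        coprime5_kernel_nonneg has_sum_coprime5_kernel_prime_powers])
  \<comment> \<open>The denominator 2(1 - p^(-s)) is smallest at p = 2, so this \<open>c\<close>
    works for all primes.\<close>
  define c where "c = 1 / (2 * (1 - 2 powr (-s)))"
  have c: "c \<ge> 0" using prime_powr_neg_less_1[of 2 s] s by (simp add: c_def)
  have summ: "summable (\<lambda>n. real n powr (-2 * s))"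
    using s by (subst summable_real_powr_iff) simp
  fix N
  have le: "coprime5_factor s p \<le> exp (c * real p powr (-2 * s))" if p: "prime p" for p
  proof (cases "p = 5")
    case False
    have "real p powr (-s) \<le> 2 powr (-s)"
      using prime_ge_2_nat[OF p] s by (intro powr_mono2') auto
    then have "(real p powr (-s)) ^ 2 / (2 * (1 - real p powr (-s))) \<le> (real p powr (-s)) ^ 2 * c"
      unfolding c_def using prime_powr_neg_less_1[of 2 s] prime_powr_neg_less_1[OF p, of s] s
      by (simp only: times_divide_eq_right mult_1_right) (intro divide_left_mono, auto)
    moreover have "(real p powr (-s)) ^ 2 = real p powr (-2 * s)"
      by (simp add: power2_eq_square flip: powr_add)
    ultimately have "coprime5_factor s p \<le> 1 + c * real p powr (-2 * s)"
      using False by (simp add: coprime5_factor_def mult.commute)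
    also have "\<dots> \<le> exp (c * real p powr (-2 * s))" by simp
    finally show ?thesis .
  qed (use c in \<open>simp add: coprime5_factor_def\<close>)
  have nn: "coprime5_factor s p \<ge> 0" if "prime p" for p
    using prime_powr_neg_less_1[OF that, of s] s by (simp add: coprime5_factor_def)
  have "(\<Prod>p | prime p \<and> p \<le> N. coprime5_factor s p)
      \<le> (\<Prod>p | prime p \<and> p \<le> N. exp (c * real p powr (-2 * s)))"
    using le nn by (intro prod_mono) auto
  also have "\<dots> = exp (c * (\<Sum>p | prime p \<and> p \<le> N. real p powr (-2 * s)))"
    by (simp add: exp_sum sum_distrib_left)
  also have "\<dots> \<le> exp (c * (\<Sum>n. real n powr (-2 * s)))"
    using c by (intro exp_le_cancel_iff[THEN iffD2] mult_left_mono sum_le_suminf[OF summ]) auto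
  finally show "(\<Prod>p | prime p \<and> p \<le> N. coprime5_factor s p) \<le> exp (c * (\<Sum>n. real n powr (-2 * s)))" .
qed (use s in auto)

section \<open>Evaluation of the constant through the Euler product of \<zeta>(2)\<close>

lemma prime_product_zeta_2:
  "(\<lambda>N. \<Prod>p | prime p \<and> p \<le> N. 1 / (1 - 1 / real p ^ 2)) \<longlonglongrightarrow> pi\<^sup>2 / 6"
\<comment> \<open>The function n^(-2) has geometric series as local factors, and its total is
  Euler's sum of inverse squares.\<close>
proof (rule euler_product_LIMSEQ)
  show "multiplicative (\<lambda>n. real n powr (-2))" by (rule multiplicative_powr)
  show "((\<lambda>k. real (p ^ k) powr (-2)) has_sum 1 / (1 - 1 / real p ^ 2)) UNIV" if p: "prime p" for p
  proof (rule sums_nonneg_imp_has_sum)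
    have "(1 / real p ^ 2) < 1" using prime_gt_1_nat[OF p] by simp
    moreover have "real (p ^ k) powr (-2) = (1 / real p ^ 2) ^ k" for k
      by (simp add: powr_minus field_simps flip: power_mult)
    ultimately show "(\<lambda>k. real (p ^ k) powr (-2)) sums (1 / (1 - 1 / real p ^ 2))"
      using geometric_sums[of "1 / real p ^ 2"] by simp
  qed auto
  have "(\<lambda>n. 1 / (real n + 1)\<^sup>2) sums (pi\<^sup>2 / 6)"
    using inverse_squares_sums by (simp add: add.commute)
  moreover have "1 / (real n + 1)\<^sup>2 = real (Suc n) powr (-2)" for n
    by (simp add: powr_minus inverse_eq_divide add.commute)
  ultimately have "(\<lambda>n. real (Suc n) powr (-2)) sums (pi\<^sup>2 / 6)" by simp
  then have "((\<lambda>n. real (Suc n) powr (-2)) has_sum pi\<^sup>2 / 6) UNIV"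
    by (rule sums_nonneg_imp_has_sum) simp
  then show "((\<lambda>n. real n powr (-2)) has_sum pi\<^sup>2 / 6) {0<..}"
    unfolding greaterThan_0 by (subst has_sum_reindex) (simp_all add: o_def)
qed auto

lemma euler_product_LIMSEQ_primes:
  "(\<lambda>N. \<Prod>p | prime p \<and> p \<le> N. euler_factor p) \<longlonglongrightarrow> euler_product"
proof -
  have "(\<Prod>p\<le>N. if prime p then euler_factor p else 1) = (\<Prod>p | prime p \<and> p \<le> N. euler_factor p)" for N
    by (rule prod.mono_neutral_cong_right) auto
  then show ?thesis
    using convergent_prod_LIMSEQ[OF convergent_euler_product] by (simp add: euler_product_def)
qed

text \<open>Away from 5 both sides equal (2x^3 - x + 1)/(2x(x^2 - 1)) with x = p. At 5 the left side
  has factor 1, and 41/40 = 1 + 1/(2*5*4) restores the missing one.\<close>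

lemma coprime5_factor_1:
  assumes p: "prime p"
  shows "coprime5_factor 1 p * (if p = 5 then 41 / 40 else 1) = euler_factor p * (1 / (1 - 1 / real p ^ 2))"
proof (cases "p = 5")
  case False
  define x where "x = real p"
  have x: "x > 1" using prime_gt_1_nat[OF p] by (simp add: x_def)
  then have x2: "x ^ 2 > 1" by simp
  have "1 + (1 / x) ^ 2 / (2 * (1 - 1 / x)) = (2 * x ^ 2 - 2 * x + 1) / (2 * x * (x - 1))"
    using x by (simp add: divide_simps) (simp add: algebra_simps power2_eq_square)
  also have "\<dots> = (2 * x ^ 2 - 2 * x + 1) * (x + 1) / (2 * x * (x ^ 2 - 1))"
  proof -
    have "2 * x * (x ^ 2 - 1) = 2 * x * (x - 1) * (x + 1)"
      by (simp add: algebra_simps power2_eq_square)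
    then show ?thesis using x by simp
  qed
  also have "\<dots> = (2 * x ^ 3 - x + 1) / (2 * x * (x ^ 2 - 1))"
    by (simp add: algebra_simps power2_eq_square power3_eq_cube)
  also have "\<dots> = (1 - 1 / (2 * x ^ 2) + 1 / (2 * x ^ 3)) * (1 / (1 - 1 / x ^ 2))"
  proof -
    have "1 - 1 / (2 * x ^ 2) + 1 / (2 * x ^ 3) = (2 * x ^ 3 - x + 1) / (2 * x ^ 3)"
      using x by (simp add: field_simps power2_eq_square power3_eq_cube)
    moreover have "1 / (1 - 1 / x ^ 2) = x ^ 2 / (x ^ 2 - 1)"
      using x x2 by (simp add: field_simps)
    ultimately show ?thesis
      using x x2 by (simp add: power2_eq_square power3_eq_cube)
  qed
  finally have "1 + (1 / x) ^ 2 / (2 * (1 - 1 / x)) = (1 - 1 / (2 * x ^ 2) + 1 / (2 * x ^ 3)) * (1 / (1 - 1 / x ^ 2))" .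
  moreover have "real p powr (-1) = 1 / x" using x by (simp add: powr_minus x_def divide_inverse)
  ultimately show ?thesis
    unfolding coprime5_factor_def euler_factor_def using False by (simp only: x_def if_False mult_1_right)
qed (simp add: coprime5_factor_def euler_factor_def)

lemma infsum_coprime5_kernel: "infsum (coprime5_kernel 1) {0<..} = 40 / 41 * (pi\<^sup>2 / 6 * euler_product)"
proof -
  let ?P = "\<lambda>N. {p. prime p \<and> p \<le> (N::nat)}"
  have lim': "(\<lambda>N. \<Prod>p\<in>?P N. coprime5_factor 1 p) \<longlonglongrightarrow> infsum (coprime5_kernel 1) {0<..}"
    by (rule euler_product_LIMSEQ[OF multiplicative_coprime5_kernel coprime5_kernel_nonneg
          has_sum_coprime5_kernel_prime_powers])
       (auto intro!: has_sum_infsum summable_on_coprime5_kernel)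
  have lim: "(\<lambda>N. 40 / 41 * ((\<Prod>p\<in>?P N. 1 / (1 - 1 / real p ^ 2)) * (\<Prod>p\<in>?P N. euler_factor p)))
      \<longlonglongrightarrow> 40 / 41 * (pi\<^sup>2 / 6 * euler_product)"
    by (intro tendsto_intros prime_product_zeta_2 euler_product_LIMSEQ_primes)
  have ev: "\<forall>\<^sub>F N in sequentially.
      40 / 41 * ((\<Prod>p\<in>?P N. 1 / (1 - 1 / real p ^ 2)) * (\<Prod>p\<in>?P N. euler_factor p)) =
      (\<Prod>p\<in>?P N. coprime5_factor 1 p)"
  \<comment> \<open>Once N \<ge> 5 the prime 5 is in the range and the correction 41/40 occurs
    exactly once.\<close>
  proof (rule eventually_sequentiallyI[of 5])
    fix N :: nat assume "N \<ge> 5"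
    have "(\<Prod>p\<in>?P N. 1 / (1 - 1 / real p ^ 2)) * (\<Prod>p\<in>?P N. euler_factor p) =
        (\<Prod>p\<in>?P N. coprime5_factor 1 p * (if p = 5 then 41 / 40 else 1))"
      unfolding prod.distrib[symmetric]
      by (intro prod.cong) (auto simp: coprime5_factor_1 mult.commute)
    also have "\<dots> = (\<Prod>p\<in>?P N. coprime5_factor 1 p) * (41 / 40)"
      using \<open>N \<ge> 5\<close> by (simp add: prod.distrib)
    finally show "40 / 41 * ((\<Prod>p\<in>?P N. 1 / (1 - 1 / real p ^ 2)) * (\<Prod>p\<in>?P N. euler_factor p)) =
        (\<Prod>p\<in>?P N. coprime5_factor 1 p)" by simp
  qed
  show ?thesis
    by (rule LIMSEQ_unique[OF lim' Lim_transform_eventually[OF lim ev]])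
qed

section \<open>Summation over integers prime to 5\<close>

definition coprime5_count :: "real \<Rightarrow> nat" where
  "coprime5_count y = card {k. 0 < k \<and> real k \<le> y \<and> \<not> 5 dvd k}"

lemma finite_nat_le_real: "finite {n::nat. P n \<and> real n \<le> x}"
  by (rule finite_subset[of _ "{..nat \<lfloor>x\<rfloor>}"]) (auto simp: le_nat_floor)

lemma coprime5_count_eq: "coprime5_count y = nat \<lfloor>y\<rfloor> - nat \<lfloor>y\<rfloor> div 5"
proof -
  define N where "N = nat \<lfloor>y\<rfloor>"
  have le: "real k \<le> y \<longleftrightarrow> k \<le> N" if "k > 0" for k
    using that unfolding N_def by linarith
  have "{k. 0 < k \<and> real k \<le> y \<and> \<not> 5 dvd k} = {0<..N} - (*) 5 ` {0<..N div 5}"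
  proof (intro set_eqI)
    fix k
    have "k \<in> (*) 5 ` {0<..N div 5} \<longleftrightarrow> 5 dvd k \<and> 0 < k \<and> k \<le> N"
      by (auto simp: image_iff)
    then show "k \<in> {k. 0 < k \<and> real k \<le> y \<and> \<not> 5 dvd k} \<longleftrightarrow> k \<in> {0<..N} - (*) 5 ` {0<..N div 5}"
      using le by auto
  qed
  moreover have "card ({0<..N} - (*) 5 ` {0<..N div 5}) = N - N div 5"
    by (subst card_Diff_subset) (auto simp: card_image inj_on_def)
  ultimately show ?thesis by (simp add: coprime5_count_def N_def)
qed

text \<open>For y < 1 the count is 0 and y \<le> y^s; for y \<ge> 1 the error is at most 1 \<le>
  y^s. Covering small \<open>y\<close> too allows summation over all \<open>d\<close>, without
  truncation at \<open>x\<close>.\<close>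

lemma coprime5_count_approx:
  assumes y: "y > 0" and s: "0 \<le> s" "s \<le> 1"
  shows "\<bar>real (coprime5_count y) - 4 / 5 * y\<bar> \<le> y powr s"
proof (cases "y < 1")
  case True
  then have "coprime5_count y = 0" using y by (simp add: coprime5_count_eq)
  moreover have "y powr 1 \<le> y powr s" using y s True by (intro powr_mono') auto
  ultimately show ?thesis using y by simp
next
  case False
  define N where "N = nat \<lfloor>y\<rfloor>"
  have "real N \<le> y" "y < real N + 1" unfolding N_def using y by linarith+
  moreover have "real (coprime5_count y) = real N - real (N div 5)"
    by (simp add: coprime5_count_eq N_def)
  moreover have "5 * real (N div 5) \<le> real N" "real N \<le> 5 * real (N div 5) + 4" by linarith+
  ultimately have "\<bar>real (coprime5_count y) - 4 / 5 * y\<bar> \<le> 1" by linarith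
  also have "1 \<le> y powr s" using False s by (simp add: ge_one_powr_ge_zero)
  finally show ?thesis .
qed

text \<open>Write n = d * k and exchange the summations. As 5 is prime, n is prime to 5 exactly when
  both d and k are.\<close>

lemma sum_divisor_ratio_coprime5:
  "(\<Sum>n | \<not> 5 dvd n \<and> real n \<le> x. divisor_ratio n) =
   (\<Sum>d | \<not> 5 dvd d \<and> real d \<le> x. ratio_kernel d * coprime5_count (x / real d))"
proof -
  let ?D = "{n::nat. \<not> 5 dvd n \<and> real n \<le> x}"
  let ?K = "\<lambda>d. {k::nat. 0 < k \<and> real k \<le> x / real d \<and> \<not> 5 dvd k}"
  have pos: "n > 0" if "n \<in> ?D" for n using that by (auto intro: Nat.gr0I)
  have fin: "finite (?K d)" for d
    by (rule finite_subset[OF _ finite_nat_le_real[of "\<lambda>_. True" "x / real d"]]) auto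
  have "(\<Sum>n\<in>?D. divisor_ratio n) = (\<Sum>n\<in>?D. \<Sum>d | d dvd n. ratio_kernel d)"
    using pos by (intro sum.cong refl divisor_ratio_eq_sum)
  also have "\<dots> = (\<Sum>(n, d)\<in>Sigma ?D (\<lambda>n. {d. d dvd n}). ratio_kernel d)"
    using pos by (intro sum.Sigma finite_nat_le_real ballI finite_divisors_nat) auto
  also have "\<dots> = (\<Sum>(d, k)\<in>Sigma ?D ?K. ratio_kernel d)"
  proof (rule sum.reindex_bij_witness[where i = "\<lambda>(d, k). (d * k, d)" and j = "\<lambda>(n, d). (d, n div d)"])
    fix a assume "a \<in> Sigma ?D (\<lambda>n. {d. d dvd n})"
    then obtain d k where a: "a = (d * k, d)" "d * k \<in> ?D" by (force simp del: of_nat_mult elim: dvdE)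
    then have "d > 0" "k > 0" using pos by force+
    moreover have "real d \<le> x"
      using a(2) mult_left_mono[of 1 "real k" "real d"] \<open>k > 0\<close> by simp
    ultimately show "(\<lambda>(n, d). (d, n div d)) a \<in> Sigma ?D ?K"
      using a by (auto simp: field_simps)
    show "(\<lambda>(d, k). (d * k, d)) ((\<lambda>(n, d). (d, n div d)) a) = a"
      "(case (case a of (n, d) \<Rightarrow> (d, n div d)) of (d, k) \<Rightarrow> ratio_kernel d) =
          (case a of (n, d) \<Rightarrow> ratio_kernel d)"
      using a by auto
  next
    fix b assume "b \<in> Sigma ?D ?K"
    then obtain d k where b: "b = (d, k)" "d \<in> ?D" "k \<in> ?K d" by auto
    then have "d > 0" using pos by auto
    moreover have "\<not> 5 dvd d * k" using b prime_dvd_mult_iff[of 5 d k] by auto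
    ultimately show "(\<lambda>(d, k). (d * k, d)) b \<in> Sigma ?D (\<lambda>n. {d. d dvd n})"
      "(\<lambda>(n, d). (d, n div d)) ((\<lambda>(d, k). (d * k, d)) b) = b"
      using b by (auto simp: field_simps)
  qed
  also have "\<dots> = (\<Sum>d\<in>?D. \<Sum>k\<in>?K d. ratio_kernel d)"
    using fin by (intro sum.Sigma[symmetric] finite_nat_le_real) auto
  also have "\<dots> = (\<Sum>d\<in>?D. ratio_kernel d * coprime5_count (x / real d))"
    by (simp add: coprime5_count_def mult.commute)
  finally show ?thesis .
qed

lemma sum_divisor_ratio_coprime5_asymp:
  assumes x: "x > 0" and s: "1 / 2 < s" "s \<le> 1"
  shows "\<bar>(\<Sum>n | \<not> 5 dvd n \<and> real n \<le> x. divisor_ratio n) - 16 * pi\<^sup>2 / 123 * euler_product * x\<bar>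
         \<le> infsum (coprime5_kernel s) {0<..} * x powr s"
proof -
  let ?D = "{n::nat. \<not> 5 dvd n \<and> real n \<le> x}"
  let ?t = "\<lambda>d. coprime5_kernel 0 d * real (coprime5_count (x / real d))"
  \<comment> \<open>For d > x the count is 0, and for multiples of 5 the kernel is 0, so the finite
    sum is a sum over all positive \<open>d\<close>.\<close>
  have "(?t has_sum sum ?t ?D) {0<..}"
  proof (rule has_sum_finite_neutralI[of ?D])
    show "?D \<subseteq> {0<..}" by (auto intro: Nat.gr0I)
    fix d assume d: "d \<in> {0<..} - ?D"
    show "?t d = 0"
    proof (cases "5 dvd d")
      case False
      then have "x / real d < 1" using d by auto
      then show ?thesis using x by (simp add: coprime5_count_eq)
    qed (simp add: coprime5_kernel_def)
  qed (auto simp: finite_nat_le_real)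
  moreover have "sum ?t ?D = (\<Sum>n\<in>?D. divisor_ratio n)"
    unfolding sum_divisor_ratio_coprime5
    by (intro sum.cong refl) (auto simp: coprime5_kernel_def)
  moreover have "((\<lambda>d. coprime5_kernel 1 d * (4 / 5 * x)) has_sum
      infsum (coprime5_kernel 1) {0<..} * (4 / 5 * x)) {0<..}"
    by (intro has_sum_cmult_left has_sum_infsum summable_on_coprime5_kernel) auto
  ultimately have diff: "((\<lambda>d. ?t d - coprime5_kernel 1 d * (4 / 5 * x)) has_sum
      (\<Sum>n\<in>?D. divisor_ratio n) - infsum (coprime5_kernel 1) {0<..} * (4 / 5 * x)) {0<..}"
    unfolding diff_conv_add_uminus by (intro has_sum_add has_sum_uminusI) simp_all
  have bound: "((\<lambda>d. coprime5_kernel s d * x powr s) has_sum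
      infsum (coprime5_kernel s) {0<..} * x powr s) {0<..}"
    using s by (intro has_sum_cmult_left has_sum_infsum summable_on_coprime5_kernel) auto
  have "norm ((\<Sum>n\<in>?D. divisor_ratio n) - infsum (coprime5_kernel 1) {0<..} * (4 / 5 * x))
      \<le> infsum (coprime5_kernel s) {0<..} * x powr s"
  proof (rule norm_infsum_le[OF diff bound])
    fix d :: nat assume "d \<in> {0<..}"
    then have d: "real d > 0" by simp
    have k1: "coprime5_kernel 1 d = coprime5_kernel 0 d / real d"
      and ks: "coprime5_kernel s d = coprime5_kernel 0 d / real d powr s"
      using d by (simp_all add: coprime5_kernel_def powr_minus divide_inverse)
    have "?t d - coprime5_kernel 1 d * (4 / 5 * x) =
        coprime5_kernel 0 d * (real (coprime5_count (x / real d)) - 4 / 5 * (x / real d))"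
      by (simp add: k1 algebra_simps)
    then have "\<bar>?t d - coprime5_kernel 1 d * (4 / 5 * x)\<bar> =
        coprime5_kernel 0 d * \<bar>real (coprime5_count (x / real d)) - 4 / 5 * (x / real d)\<bar>"
      by (simp only: abs_mult abs_of_nonneg[OF coprime5_kernel_nonneg])
    also have "\<dots> \<le> coprime5_kernel 0 d * (x / real d) powr s"
      using x d s by (intro mult_left_mono coprime5_count_approx coprime5_kernel_nonneg) auto
    also have "\<dots> = coprime5_kernel s d * x powr s"
      using x d by (simp add: ks powr_divide)
    finally show "norm (?t d - coprime5_kernel 1 d * (4 / 5 * x)) \<le> coprime5_kernel s d * x powr s"
      by simp
  qed
  \<comment> \<open>The rational factor is 40/41 * 1/6 * 4/5 = 16/123.\<close>
  moreover have "infsum (coprime5_kernel 1) {0<..} * (4 / 5 * x) = 16 * pi\<^sup>2 / 123 * euler_product * x"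
    by (simp add: infsum_coprime5_kernel)
  ultimately show ?thesis by (simp only: real_norm_def)
qed

section \<open>Subpolynomial growth of the divisor ratio\<close>

text \<open>The ratio is a product of local terms (k + 1)/2. Large primes satisfy (k + 1)/2 \<le>
  p^(k\<epsilon>) outright; each of the boundedly many small ones costs at most a constant factor
  \<open>c\<close>.\<close>

lemma divisor_ratio_subpolynomial:
  assumes e: "\<epsilon> > 0"
  obtains C where "C > 0" "\<And>n. n > 0 \<Longrightarrow> divisor_ratio n \<le> C * real n powr \<epsilon>"
proof -
  \<comment> \<open>Chosen so that 1 + k \<le> c(1 + k\<epsilon> ln 2) \<le> c
    2^(k\<epsilon>).\<close>
  define c where "c = max 1 (1 / (\<epsilon> * ln 2))"
  \<comment> \<open>For p \<ge> P one has p^\<epsilon> \<ge> 2, hence p^(k\<epsilon>) \<ge> 2^k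
    \<ge> k + 1.\<close>
  define P where "P = nat \<lceil>2 powr (1 / \<epsilon>)\<rceil>"
  have c: "c \<ge> 1" "c * (\<epsilon> * ln 2) \<ge> 1"
    using e by (auto simp: c_def field_simps max_def)
  let ?S = "\<lambda>n. {q \<in> prime_factors n. q < P}"
  have small: "real (k + 1) / 2 \<le> c * real (p ^ k) powr \<epsilon>" if "prime p" for p k
  proof -
    have "real (k + 1) / 2 \<le> 1 + real k * 1" by simp
    also have "\<dots> \<le> c + real k * (c * (\<epsilon> * ln 2))"
      using c by (intro add_mono mult_left_mono) auto
    also have "\<dots> = c * (1 + real k * (\<epsilon> * ln 2))" by (simp add: algebra_simps)
    also have "\<dots> \<le> c * exp (real k * (\<epsilon> * ln 2))"
      using c by (intro mult_left_mono exp_ge_add_one_self) auto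
    also have "exp (real k * (\<epsilon> * ln 2)) = (2 ^ k) powr \<epsilon>"
      by (simp add: powr_def ln_realpow mult_ac)
    also have "c * (2 ^ k) powr \<epsilon> \<le> c * real (p ^ k) powr \<epsilon>"
      using prime_ge_2_nat[OF that] e c by (intro mult_left_mono powr_mono2) (auto intro: power_mono)
    finally show ?thesis .
  qed
  have large: "real (k + 1) / 2 \<le> real (p ^ k) powr \<epsilon>" if "p \<ge> P" "prime p" for p k
  proof -
    have "2 powr (1 / \<epsilon>) \<le> real p" using that unfolding P_def by linarith
    then have "(2 powr (1 / \<epsilon>)) powr \<epsilon> \<le> real p powr \<epsilon>"
      using e by (intro powr_mono2) auto
    then have "2 \<le> real p powr \<epsilon>" using e by (simp add: powr_powr)
    then have "2 ^ k \<le> (real p powr \<epsilon>) ^ k" by (intro power_mono) auto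
    also have "\<dots> = real (p ^ k) powr \<epsilon>"
      using prime_gt_0_nat[OF that(2)] by (simp add: powr_realpow[symmetric] powr_powr mult.commute powr_power)
    finally have "2 ^ k \<le> real (p ^ k) powr \<epsilon>" .
    moreover have "real (k + 1) \<le> 2 ^ k" by (induction k) auto
    ultimately show ?thesis by simp
  qed
  have main: "divisor_ratio n \<le> c ^ card (?S n) * real n powr \<epsilon>" if "n > 0" for n
    using that
  proof (induction n rule: prime_power_induct)
    case one
    then show ?case by (simp add: divisor_ratio_1)
  next
    case (step p k m)
    have pf: "prime_factors (p ^ k * m) = insert p (prime_factors m)"
      using step.hyps by (simp add: prime_factorization_mult prime_factorization_prime_power prime_gt_0_nat)
    have np: "p \<notin> prime_factors m" using step.hyps by auto
    have fac: "real (k + 1) / 2 \<le> c ^ (if p < P then 1 else 0) * real (p ^ k) powr \<epsilon>"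
      using small[of p k] large[of p k] step.hyps by auto
    have S: "c ^ card (?S (p ^ k * m)) = c ^ (if p < P then 1 else 0) * c ^ card (?S m)"
    proof (cases "p < P")
      case True
      then have "?S (p ^ k * m) = insert p (?S m)" using pf by auto
      then show ?thesis using True np by simp
    next
      case False
      then have "?S (p ^ k * m) = ?S m" using pf by auto
      then show ?thesis using False by simp
    qed
    have "divisor_ratio (p ^ k * m) = real (k + 1) / 2 * divisor_ratio m"
      using step.hyps by (intro divisor_ratio_prime_power_mult)
    also have "\<dots> \<le> (c ^ (if p < P then 1 else 0) * real (p ^ k) powr \<epsilon>) *
        (c ^ card (?S m) * real m powr \<epsilon>)"
      using c by (intro mult_mono fac step.IH divisor_ratio_nonneg mult_nonneg_nonneg) auto
    also have "\<dots> = c ^ card (?S (p ^ k * m)) * real (p ^ k * m) powr \<epsilon>"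
      unfolding S by (simp add: powr_mult mult_ac)
    finally show ?case .
  qed
  show ?thesis
  proof (rule that[of "c ^ P"])
    fix n :: nat assume "n > 0"
    have "card (?S n) \<le> card {..<P}" by (intro card_mono) auto
    then have "c ^ card (?S n) \<le> c ^ P" using c by (intro power_increasing) auto
    then show "divisor_ratio n \<le> c ^ P * real n powr \<epsilon>"
      using main[OF \<open>n > 0\<close>] by (meson mult_right_mono order_trans powr_ge_zero)
  qed (use c in simp)
qed

section \<open>Decimal digits\<close>

lemma decimal_digits_less_10: "d \<in> set (decimal_digits n) \<Longrightarrow> d < 10"
proof (induction n rule: decimal_digits.induct)
  case (1 n)
  then show ?case
    by (subst (asm) (2) decimal_digits.simps) (auto split: if_splits)
qed

text \<open>Divisibility by 5 depends only on the last digit, the head of the list, which must be 0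
  or 5. Conversely, such a digit can be moved to the head.\<close>

lemma mem_B_multiples_of_5_iff:
  "n \<in> B_multiples_of_5 \<longleftrightarrow> \<not> 5 dvd n \<and> (0 \<in> set (decimal_digits n) \<or> 5 \<in> set (decimal_digits n))"
proof (intro iffI; (elim conjE)?)
  assume "n \<in> B_multiples_of_5"
  then obtain ds where n: "n > 0" "\<not> 5 dvd n"
    and ds: "mset ds = mset (decimal_digits n)" "5 dvd decimal_value ds"
    by (auto simp: B_multiples_of_5_def)
  have set_eq: "set ds = set (decimal_digits n)" using ds(1) by (metis set_mset_mset)
  have "decimal_digits n \<noteq> []" using n by (subst decimal_digits.simps) simp
  then obtain d es where "ds = d # es" using ds(1) by (cases ds) auto
  then have "d \<in> set (decimal_digits n)" "5 dvd d + 10 * decimal_value es"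
    using set_eq ds(2) by auto
  moreover have "5 dvd 10 * decimal_value es" by (rule dvd_mult2) simp
  ultimately have "5 dvd d" "d < 10" "d \<in> set (decimal_digits n)"
    using decimal_digits_less_10 dvd_add_left_iff by blast+
  moreover from this(1,2) have "d = 0 \<or> d = 5" by presburger
  ultimately show "\<not> 5 dvd n \<and> (0 \<in> set (decimal_digits n) \<or> 5 \<in> set (decimal_digits n))"
    using n by auto
next
  assume n: "\<not> 5 dvd n" and "0 \<in> set (decimal_digits n) \<or> 5 \<in> set (decimal_digits n)"
  then obtain d where d: "d \<in> set (decimal_digits n)" "5 dvd d" by auto
  let ?ds = "d # remove1 d (decimal_digits n)"
  have "mset ?ds = mset (decimal_digits n)" using d by simp
  moreover have "5 dvd 10 * decimal_value (remove1 d (decimal_digits n))"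
    by (rule dvd_mult2) simp
  then have "5 dvd decimal_value ?ds" using d(2) by simp
  ultimately have "\<exists>ds. mset ds = mset (decimal_digits n) \<and> 5 dvd decimal_value ds" by blast
  then show "n \<in> B_multiples_of_5"
    using n unfolding B_multiples_of_5_def by (auto intro: Nat.gr0I)
qed

section \<open>Counting integers without the digits 0 and 5\<close>

text \<open>Positivity excludes 0, whose digit list is empty.\<close>

definition free_of_0_5 :: "nat set" where
  "free_of_0_5 = {n. n > 0 \<and> 0 \<notin> set (decimal_digits n) \<and> 5 \<notin> set (decimal_digits n)}"

lemma free_of_0_5_rec:
  "n \<in> free_of_0_5 \<longleftrightarrow> n mod 10 \<notin> {0, 5} \<and> (n div 10 = 0 \<or> n div 10 \<in> free_of_0_5)"
proof (cases "n = 0")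
  case False
  then have "decimal_digits n = n mod 10 # decimal_digits (n div 10)"
    by (subst decimal_digits.simps) simp
  moreover have "decimal_digits 0 = []" by (subst decimal_digits.simps) simp
  ultimately show ?thesis using False by (auto simp: free_of_0_5_def)
qed (simp add: free_of_0_5_def)

text \<open>This fixes the exponent: one more decimal place multiplies the count by about 8, the
  number of digits other than 0 and 5.\<close>

lemma ten_powr_ln8_ln10: "(10::real) powr (ln 8 / ln 10) = 8"
  by (simp add: powr_def)

text \<open>The summand \<open>-2\<close> is slack that lets the induction absorb the one-digit numbers.\<close>

lemma card_free_of_0_5_le:
  assumes "N > 0"
  shows "real (card {n \<in> free_of_0_5. n \<le> N}) \<le> 16 * real N powr (ln 8 / ln 10) - 2"
  using assms
proof (induction N rule: less_induct)
  case (less N)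
  let ?A = "\<lambda>N. {n \<in> free_of_0_5. n \<le> N}" and ?\<theta> = "ln 8 / ln 10 :: real"
  let ?D = "{..<10} - {0, 5 :: nat}"
  have fin: "finite (?A N)" for N by (rule finite_subset[of _ "{..N}"]) auto
  \<comment> \<open>Strip the last digit, for which 8 values remain; the inserted 0 is the prefix of
    one-digit numbers.\<close>
  have "?A N \<subseteq> (\<lambda>(m, d). 10 * m + d) ` (insert 0 (?A (N div 10)) \<times> ?D)"
  proof
    fix n assume n: "n \<in> ?A N"
    then have "n mod 10 \<notin> {0, 5}" "n div 10 \<in> insert 0 (?A (N div 10))"
      using free_of_0_5_rec[of n] by (auto intro: div_le_mono)
    moreover have "n mod 10 < 10" by simp
    ultimately have "(n div 10, n mod 10) \<in> insert 0 (?A (N div 10)) \<times> ?D"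
      by auto
    moreover have "n = (\<lambda>(m, d). 10 * m + d) (n div 10, n mod 10)" by simp
    ultimately show "n \<in> (\<lambda>(m, d). 10 * m + d) ` (insert 0 (?A (N div 10)) \<times> ?D)" by blast
  qed
  then have "card (?A N) \<le> card (insert 0 (?A (N div 10)) \<times> ?D)"
    using fin by (intro surj_card_le) auto
  also have "\<dots> = card (insert 0 (?A (N div 10))) * 8"
    by (simp add: card_cartesian_product card_Diff_subset)
  also have "\<dots> \<le> (card (?A (N div 10)) + 1) * 8"
    by (intro mult_right_mono order.trans[OF card_insert_le_m1]) (use fin in \<open>auto simp: card_insert_if\<close>)
  finally have "real (card (?A N)) \<le> real ((card (?A (N div 10)) + 1) * 8)"
    by (rule of_nat_mono)
  then have rec: "real (card (?A N)) \<le> 8 * (real (card (?A (N div 10))) + 1)" by simp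
  show ?case
  proof (cases "N div 10 = 0")
    case True
    have "?A (N div 10) = {}" using True by (auto simp: free_of_0_5_def)
    with rec have "real (card (?A N)) \<le> 8" by (simp only: card.empty) simp
    moreover have "real N powr ?\<theta> \<ge> 1" using less.prems by (intro ge_one_powr_ge_zero) auto
    ultimately show ?thesis by linarith
  next
    case False
    then have IH: "real (card (?A (N div 10))) \<le> 16 * real (N div 10) powr ?\<theta> - 2"
      by (intro less.IH) auto
    have "real (N div 10) powr ?\<theta> \<le> (real N / 10) powr ?\<theta>"
      by (intro powr_mono2) (auto simp: of_nat_div_le_of_nat)
    also have "\<dots> = real N powr ?\<theta> / 8" by (simp add: powr_divide ten_powr_ln8_ln10)
    finally have "real (N div 10) powr ?\<theta> \<le> real N powr ?\<theta> / 8" .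
    \<comment> \<open>The slack closes the induction: 8((2u - 2) + 1) = 16u - 8 \<le> 16u -
      2.\<close>
    moreover have "a \<le> 16 * u - 2" if "t \<le> u / 8" "a \<le> 8 * (b + 1)" "b \<le> 16 * t - 2" for a b t u :: real
      using that by (simp add: field_simps)
    ultimately show ?thesis using rec IH by blast
  qed
qed

section \<open>Assembly: integers prime to 5, minus those without the digits 0 and 5\<close>

theorem theorem1:
  fixes \<epsilon> :: real
  assumes "\<epsilon> > 0"
  shows "\<exists>C::real. \<forall>x::real. x \<ge> 1 \<longrightarrow>
           \<bar>(\<Sum>n\<in>{n \<in> B_multiples_of_5. real n \<le> x}.
                real (num_divisors n) / real (num_unitary_divisors n))
              - 16 * pi\<^sup>2 / 123 * euler_product * x\<bar>
           \<le> C * x powr (ln 8 / ln 10 + \<epsilon>)"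
proof -
  define \<theta> :: real where "\<theta> = ln 8 / ln 10"
  \<comment> \<open>Since 10 < 8^2, the exponent \<theta> exceeds 1/2, so
    \<open>s = \<theta>\<close> is admissible for the sum over all integers prime to 5.\<close>
  have \<theta>: "1 / 2 < \<theta>" "\<theta> \<le> 1"
  proof -
    have "ln (10::real) < ln (8 ^ 2)" by (subst ln_less_cancel_iff) auto
    also have "\<dots> = 2 * ln 8" by (subst ln_realpow) auto
    finally have "ln 10 < 2 * ln (8::real)" .
    then show "1 / 2 < \<theta>" "\<theta> \<le> 1" by (simp_all add: \<theta>_def field_simps)
  qed
  obtain C where C: "C > 0" "\<And>n. n > 0 \<Longrightarrow> divisor_ratio n \<le> C * real n powr \<epsilon>"
    using divisor_ratio_subpolynomial[OF assms] by blast
  define K where "K = infsum (coprime5_kernel \<theta>) {0<..}"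
  have K: "K \<ge> 0" unfolding K_def by (intro infsum_nonneg coprime5_kernel_nonneg)
  show ?thesis
  \<comment> \<open>\<open>K\<close> bounds the error over integers prime to 5;
    \<open>16 * C\<close> is the digit count's constant times that of the pointwise bound.\<close>
  proof (intro exI[of _ "K + 16 * C"] allI impI)
    fix x :: real assume x: "x \<ge> 1"
    let ?U = "{n::nat. \<not> 5 dvd n \<and> real n \<le> x}"
    let ?V = "{n \<in> free_of_0_5. real n \<le> x}"
    let ?M = "16 * pi\<^sup>2 / 123 * euler_product * x"
    have fin: "finite ?U" "finite ?V" by (rule finite_nat_le_real)+
    have "\<not> 5 dvd n" if "n \<in> free_of_0_5" for n
    proof
      assume "5 dvd n"
      then have "n mod 10 \<in> {0, 5}" by auto presburger
      then show False using that free_of_0_5_rec[of n] by auto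
    qed
    then have sub: "?V \<subseteq> ?U" by auto
    have "{n \<in> B_multiples_of_5. real n \<le> x} = ?U - ?V"
      by (auto simp: mem_B_multiples_of_5_iff free_of_0_5_def intro: Nat.gr0I)
    then have split: "(\<Sum>n\<in>{n \<in> B_multiples_of_5. real n \<le> x}. divisor_ratio n) =
        (\<Sum>n\<in>?U. divisor_ratio n) - (\<Sum>n\<in>?V. divisor_ratio n)"
      using fin sub by (simp add: sum_diff)
    have "(\<Sum>n\<in>?V. divisor_ratio n) \<le> (\<Sum>n\<in>?V. C * x powr \<epsilon>)"
    proof (rule sum_mono)
      fix n assume "n \<in> ?V"
      then have n: "n > 0" "real n \<le> x" by (auto simp: free_of_0_5_def)
      have "divisor_ratio n \<le> C * real n powr \<epsilon>" using C(2) n(1) .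
      also have "\<dots> \<le> C * x powr \<epsilon>"
        using n C(1) assms by (intro mult_left_mono powr_mono2) auto
      finally show "divisor_ratio n \<le> C * x powr \<epsilon>" .
    qed
    also have "\<dots> = real (card ?V) * (C * x powr \<epsilon>)" by simp
    also have "\<dots> \<le> (16 * x powr \<theta>) * (C * x powr \<epsilon>)"
    proof (rule mult_right_mono)
      have "?V = {n \<in> free_of_0_5. n \<le> nat \<lfloor>x\<rfloor>}" using x by (auto simp: le_nat_iff le_floor_iff)
      then have "real (card ?V) \<le> 16 * real (nat \<lfloor>x\<rfloor>) powr \<theta> - 2"
        using card_free_of_0_5_le[of "nat \<lfloor>x\<rfloor>"] x by (simp add: \<theta>_def)
      also have "\<dots> \<le> 16 * real (nat \<lfloor>x\<rfloor>) powr \<theta>" by simp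
      also have "\<dots> \<le> 16 * x powr \<theta>"
        using \<theta> x by (intro mult_left_mono powr_mono2) auto
      finally show "real (card ?V) \<le> 16 * x powr \<theta>" .
    qed (use C in simp)
    also have "\<dots> = 16 * C * x powr (\<theta> + \<epsilon>)" by (simp add: powr_add)
    finally have V: "(\<Sum>n\<in>?V. divisor_ratio n) \<le> 16 * C * x powr (\<theta> + \<epsilon>)" .
    have V0: "(\<Sum>n\<in>?V. divisor_ratio n) \<ge> 0" by (intro sum_nonneg divisor_ratio_nonneg)
    have "\<bar>(\<Sum>n\<in>?U. divisor_ratio n) - ?M\<bar> \<le> K * x powr \<theta>"
      unfolding K_def using x \<theta> by (intro sum_divisor_ratio_coprime5_asymp) auto
    also have "\<dots> \<le> K * x powr (\<theta> + \<epsilon>)"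
      using x K assms by (intro mult_left_mono powr_mono) auto
    finally have U: "\<bar>(\<Sum>n\<in>?U. divisor_ratio n) - ?M\<bar> \<le> K * x powr (\<theta> + \<epsilon>)" .
    have "\<bar>(\<Sum>n\<in>{n \<in> B_multiples_of_5. real n \<le> x}. divisor_ratio n) - ?M\<bar>
        \<le> K * x powr (\<theta> + \<epsilon>) + 16 * C * x powr (\<theta> + \<epsilon>)"
      unfolding split using U V V0 by linarith
    then show "\<bar>(\<Sum>n\<in>{n \<in> B_multiples_of_5. real n \<le> x}.
        real (num_divisors n) / real (num_unitary_divisors n)) - ?M\<bar>
        \<le> (K + 16 * C) * x powr (ln 8 / ln 10 + \<epsilon>)"
      by (simp add: \<theta>_def divisor_ratio_def distrib_right)
  qed
qed

end
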